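(* Let $\varepsilon\ge0$, $\alpha_0>0$, $\alpha_1>0$. Assume that for $u=P,N$: $m_u^0,k_u^0,m_u^1,k_u^1>0$; $a_u^0,b_u^0,a_u^1,b_u^1\in[0,1]$ (with $a_P^0,a_N^0,b_P^1,b_N^1>0$); $0\le u^0\le u^{max}$ a.e. on $(0,1)$. Assume $3P^{max}-N^{max}+\rho_{hl}=0$ and $$-\frac{1}{3a_P^0}\bigl(1+\log(\alpha_0a_P^0k_P^0)\bigr)\le\Delta\Psi_0^{pzc}\le\frac{1}{a_N^0}\bigl(1+\log(\alpha_0a_N^0k_N^0)\bigr),$$ $$-\frac{1}{b_N^1}\bigl(1+\log(\alpha_1b_N^1m_N^1)\bigr)\le\Delta\Psi_1^{pzc}\le\frac{1}{3b_P^1}\bigl(1+\log(\alpha_1b_P^1m_P^1)\bigr).$$ Then, for every mesh $\mathcal T$ of $[0,1]$ and every time step $\Delta t=T/K$, there exists a solution $(P_i^{k+1},N_i^{k+1},\Psi_i^{k+1})_{0\le i\le I+1,\,0\le k\le K-1}$ of the scheme $(\mathcal S)$. Moreover it satisfies $$0\le P_i^k\le P^{max}\quad\text{and}\quad0\le N_i^k\le N^{max}$$ for all $0\le i\le I+1$ and $1\le k\le K$, as well as for all $1\le i\le I$ when $k=0$.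
   Context: **Data.** $T>0$, $\lambda>0$, $V,\rho_{hl},\Delta\Psi_0^{pzc},\Delta\Psi_1^{pzc}\in\mathbb R$, $P^{max},N^{max}>0$; constants $\alpha_0,\alpha_1,\varepsilon$ and $m_u^i,k_u^i,a_u^i,b_u^i$ ($u=P,N$, $i=0,1$); initial data $P^0,N^0\in L^\infty(0,1)$ (the generic notation is $u^0$, $u^{max}$ for $u=P,N$). Set $z_P=3$, $z_N=-1$, $\varepsilon_P=1$, $\varepsilon_N=\varepsilon$ and, for $u=P,N$, $$\beta_u^i(x)=m_u^ie^{-z_ub_u^ix}+k_u^ie^{z_ua_u^ix}\ (i=0,1),\quad \gamma_u^0(x)=m_u^0u^{max}e^{-z_ub_u^0x},\quad \gamma_u^1(x)=k_u^1u^{max}e^{z_ua_u^1x}.$$ **Mesh.** A mesh $\mathcal T$ of $[0,1]$ is given by $0=x_{1/2}<x_{3/2}<\dots<x_{I+1/2}=1$; $x_i=(x_{i-1/2}+x_{i+1/2})/2$ for $1\le i\le I$, $x_0=0$, $x_{I+1}=1$; $h_i=x_{i+1/2}-x_{i-1/2}$ ($1\le i\le I$), $h_{i+1/2}=x_{i+1}-x_i$ ($0\le i\le I$). Time step $\Delta t=T/K$, $K\in\mathbb N$, $K\ge1$. **Scheme $(\mathcal S)$.** Initial values $u_i^0=\frac1{h_i}\int_{x_{i-1/2}}^{x_{i+1/2}}u^0(x)\,dx$ ($1\le i\le I$, $u=P,N$). For $0\le k\le K-1$ the unknowns $(P_i^{k+1},N_i^{k+1},\Psi_i^{k+1})_{0\le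 i\le I+1}$ satisfy, for $1\le i\le I$, $$-\lambda^2(d\Psi_{i+1/2}^{k+1}-d\Psi_{i-1/2}^{k+1})=h_i(3P_i^{k+1}-N_i^{k+1}+\rho_{hl}),\qquad \varepsilon_uh_i\frac{u_i^{k+1}-u_i^k}{\Delta t}+\mathcal F_{u,i+1/2}^{k+1}-\mathcal F_{u,i-1/2}^{k+1}=0\ (u=P,N),$$ where for $0\le i\le I$, $d\Psi_{i+1/2}^{k+1}=(\Psi_{i+1}^{k+1}-\Psi_i^{k+1})/h_{i+1/2}$ and $$\mathcal F_{u,i+1/2}^{k+1}=\frac{B(z_uh_{i+1/2}d\Psi_{i+1/2}^{k+1})u_i^{k+1}-B(-z_uh_{i+1/2}d\Psi_{i+1/2}^{k+1})u_{i+1}^{k+1}}{h_{i+1/2}},\quad B(x)=\frac{x}{e^x-1}\ (x\ne0),\ B(0)=1,$$ together with $\Psi_0^{k+1}-\alpha_0d\Psi_{1/2}^{k+1}=\Delta\Psi_0^{pzc}$, $\Psi_{I+1}^{k+1}+\alpha_1d\Psi_{I+1/2}^{k+1}=V-\Delta\Psi_1^{pzc}$, $-\mathcal F_{u,1/2}^{k+1}=\beta_u^0(\Psi_0^{k+1})u_0^{k+1}-\gamma_u^0(\Psi_0^{k+1})$, $\mathcal F_{u,I+1/2}^{k+1}=\beta_u^1(V-\Psi_{I+1}^{k+1})u_{I+1}^{k+1}-\gamma_u^1(V-\Psi_{I+1}^{k+1})$ ($u=P,N$). *)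

theory Defs
  imports "HOL-Analysis.Analysis"
begin

text \<open>
  The index \<open>u = P, N\<close> of the paper: \<open>Cation\<close> stands for \<open>P\<close>, \<open>Electron\<close> for \<open>N\<close>.
\<close>

datatype species = Cation | Electron

fun charge :: "species \<Rightarrow> real" where
  "charge Cation = 3"
| "charge Electron = - 1"

text \<open>
  In the kinetic coefficients \<open>coef_m u i\<close>, \dots, \<open>coef_b u i\<close> the natural number \<open>i\<close> is the
  upper index of \<open>m_u^i\<close>, \dots, \<open>b_u^i\<close>; only the values at \<open>i = 0, 1\<close> are ever used.
\<close>

record corrosion_data =
  lambda :: real
  appl_pot :: real  \<comment> \<open>\<open>V\<close>\<close>
  rho_hl :: real
  pzc0 :: real  \<comment> \<open>\<open>\<Delta>\<Psi>_0^{pzc}\<close>\<close>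
  pzc1 :: real  \<comment> \<open>\<open>\<Delta>\<Psi>_1^{pzc}\<close>\<close>
  alpha0 :: real
  alpha1 :: real
  epsilon :: real
  umax :: "species \<Rightarrow> real"
  coef_m :: "species \<Rightarrow> nat \<Rightarrow> real"
  coef_k :: "species \<Rightarrow> nat \<Rightarrow> real"
  coef_a :: "species \<Rightarrow> nat \<Rightarrow> real"
  coef_b :: "species \<Rightarrow> nat \<Rightarrow> real"

fun eps_of :: "corrosion_data \<Rightarrow> species \<Rightarrow> real" where
  "eps_of D Cation = 1"
| "eps_of D Electron = epsilon D"

definition beta_fn :: "corrosion_data \<Rightarrow> species \<Rightarrow> nat \<Rightarrow> real \<Rightarrow> real" where
  "beta_fn D u i x = coef_m D u i * exp (- charge u * coef_b D u i * x)
     + coef_k D u i * exp (charge u * coef_a D u i * x)"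

definition gamma0_fn :: "corrosion_data \<Rightarrow> species \<Rightarrow> real \<Rightarrow> real" where
  "gamma0_fn D u x = coef_m D u 0 * umax D u * exp (- charge u * coef_b D u 0 * x)"

definition gamma1_fn :: "corrosion_data \<Rightarrow> species \<Rightarrow> real \<Rightarrow> real" where
  "gamma1_fn D u x = coef_k D u 1 * umax D u * exp (charge u * coef_a D u 1 * x)"

definition Linfty01 :: "(real \<Rightarrow> real) \<Rightarrow> bool" where
  "Linfty01 f \<longleftrightarrow> f \<in> borel_measurable (lebesgue_on {0<..<1})
     \<and> (\<exists>C. AE x in lebesgue_on {0<..<1}. \<bar>f x\<bar> \<le> C)"

text \<open>
  A mesh with \<open>I\<close> cells is given by its edge points; \<open>e j\<close> is the paper's \<open>x_{j+1/2}\<close>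
  (\<open>0 \<le> j \<le> I\<close>), so the \<open>i\<close>-th cell (\<open>1 \<le> i \<le> I\<close>) is \<open>(e (i - 1), e i)\<close>.
\<close>

definition is_mesh :: "nat \<Rightarrow> (nat \<Rightarrow> real) \<Rightarrow> bool" where
  "is_mesh I e \<longleftrightarrow> e 0 = 0 \<and> e I = 1 \<and> (\<forall>j<I. e j < e (j + 1))"

definition node :: "nat \<Rightarrow> (nat \<Rightarrow> real) \<Rightarrow> nat \<Rightarrow> real" where
  "node I e i = (if i = 0 then 0 else if i = I + 1 then 1 else (e (i - 1) + e i) / 2)"

definition cell_size :: "(nat \<Rightarrow> real) \<Rightarrow> nat \<Rightarrow> real" where
  "cell_size e i = e i - e (i - 1)"

text \<open>
  In the following three definitions the argument \<open>i\<close> refers to the edge \<open>i + 1/2\<close>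
  (\<open>0 \<le> i \<le> I\<close>): they are \<open>h_{i+1/2}\<close>, \<open>d\<Psi>_{i+1/2}\<close> and \<open>F_{u,i+1/2}\<close>.
\<close>

definition node_dist :: "nat \<Rightarrow> (nat \<Rightarrow> real) \<Rightarrow> nat \<Rightarrow> real" where
  "node_dist I e i = node I e (i + 1) - node I e i"

definition dPsi :: "nat \<Rightarrow> (nat \<Rightarrow> real) \<Rightarrow> (nat \<Rightarrow> real) \<Rightarrow> nat \<Rightarrow> real" where
  "dPsi I e psi i = (psi (i + 1) - psi i) / node_dist I e i"

definition bernoulli_fn :: "real \<Rightarrow> real" where
  "bernoulli_fn x = (if x = 0 then 1 else x / (exp x - 1))"

definition flux ::
  "nat \<Rightarrow> (nat \<Rightarrow> real) \<Rightarrow> species \<Rightarrow> (nat \<Rightarrow> real) \<Rightarrow> (nat \<Rightarrow> real) \<Rightarrow> nat \<Rightarrow> real" where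
  "flux I e u psi v i =
     (bernoulli_fn (charge u * node_dist I e i * dPsi I e psi i) * v i
      - bernoulli_fn (- charge u * node_dist I e i * dPsi I e psi i) * v (i + 1))
     / node_dist I e i"

text \<open>
  One time step: \<open>v u i\<close> is the known value \<open>u_i^k\<close> (used for \<open>1 \<le> i \<le> I\<close> only), while
  \<open>w u i\<close> and \<open>psi i\<close> are the unknowns \<open>u_i^{k+1}\<close> and \<open>\<Psi>_i^{k+1}\<close> (\<open>0 \<le> i \<le> I + 1\<close>).
\<close>

definition scheme_step ::
  "corrosion_data \<Rightarrow> nat \<Rightarrow> (nat \<Rightarrow> real) \<Rightarrow> real \<Rightarrow> (species \<Rightarrow> nat \<Rightarrow> real)
   \<Rightarrow> (species \<Rightarrow> nat \<Rightarrow> real) \<Rightarrow> (nat \<Rightarrow> real) \<Rightarrow> bool" where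
  "scheme_step D I e dt v w psi \<longleftrightarrow>
     (\<forall>i\<in>{1..I}. - (lambda D)\<^sup>2 * (dPsi I e psi i - dPsi I e psi (i - 1))
        = cell_size e i * (3 * w Cation i - w Electron i + rho_hl D)) \<and>
     (\<forall>u. \<forall>i\<in>{1..I}. eps_of D u * cell_size e i * ((w u i - v u i) / dt)
        + flux I e u psi (w u) i - flux I e u psi (w u) (i - 1) = 0) \<and>
     psi 0 - alpha0 D * dPsi I e psi 0 = pzc0 D \<and>
     psi (I + 1) + alpha1 D * dPsi I e psi I = appl_pot D - pzc1 D \<and>
     (\<forall>u. - flux I e u psi (w u) 0
        = beta_fn D u 0 (psi 0) * w u 0 - gamma0_fn D u (psi 0)) \<and>
     (\<forall>u. flux I e u psi (w u) I
        = beta_fn D u 1 (appl_pot D - psi (I + 1)) * w u (I + 1)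
          - gamma1_fn D u (appl_pot D - psi (I + 1)))"

text \<open>
  \<open>U u k i\<close> is \<open>u_i^k\<close> and \<open>Psi k i\<close> is \<open>\<Psi>_i^k\<close>.  The values \<open>Psi 0 i\<close>, \<open>U u 0 0\<close>,
  \<open>U u 0 (I + 1)\<close> and all values with \<open>k > K\<close> or \<open>i > I + 1\<close> are not part of the scheme
  and remain unconstrained.
\<close>

definition scheme_solution ::
  "corrosion_data \<Rightarrow> (species \<Rightarrow> real \<Rightarrow> real) \<Rightarrow> real \<Rightarrow> nat \<Rightarrow> nat \<Rightarrow> (nat \<Rightarrow> real)
   \<Rightarrow> (species \<Rightarrow> nat \<Rightarrow> nat \<Rightarrow> real) \<Rightarrow> (nat \<Rightarrow> nat \<Rightarrow> real) \<Rightarrow> bool" where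
  "scheme_solution D uinit T K I e U Psi \<longleftrightarrow>
     (\<forall>u. \<forall>i\<in>{1..I}. U u 0 i
        = (1 / cell_size e i) * (LINT x:{e (i - 1)..e i}|lebesgue. uinit u x)) \<and>
     (\<forall>k<K. scheme_step D I e (T / real K) (\<lambda>u. U u k) (\<lambda>u. U u (k + 1)) (Psi (k + 1)))"

end

theory Submission
  imports Defs
begin

text \<open>
  One time step is solved by the Poincare-Miranda theorem on the box
  \<open>0 \<le> w u i \<le> umax D u\<close>, \<open>\<bar>psi i\<bar> \<le> M * phi i\<close>, where \<open>phi\<close> is a concave supersolution
  of the discrete Poisson problem.  Since \<open>B x - B (- x) = - x\<close>, the constant state
  \<open>umax D u\<close> has flux \<open>- z * umax D u * dPsi\<close>, whose discrete divergence is, by the Poisson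
  equation and electroneutrality, a positive multiple of \<open>z\<close> times the charge of the deviation from the constant
  states; this is nonnegative when species \<open>u\<close> is at its maximum and the other one below its
  own.  At the two boundary nodes \<open>1 + y \<le> exp y\<close> turns the conditions on the pzc voltages
  into the required sign.  Subtracting multiples of the Poisson residual from the transport
  residuals makes these sign conditions hold on the faces of the box without assuming that the
  Poisson equation is satisfied.
\<close>

section \<open>The Poincare-Miranda theorem\<close>

text \<open>Kuhn's combinatorial lemma on ever finer grids of the box yields cells in which every
  \<open>f j\<close> takes both signs; a limit point of these cells is a common zero. Countability
  of the index type makes the function space first countable, so compact sets are sequentially
  compact.\<close>

theorem poincare_miranda:
  fixes J :: "'j::countable set" and a b :: "'j \<Rightarrow> real" and f :: "'j \<Rightarrow> ('j \<Rightarrow> real) \<Rightarrow> real"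
  defines "S \<equiv> {x. \<forall>j\<in>J. a j \<le> x j \<and> x j \<le> b j}"
  assumes fin: "finite J"
    and ab: "\<And>j. j \<in> J \<Longrightarrow> a j \<le> b j"
    and cont: "\<And>j. j \<in> J \<Longrightarrow> continuous_on S (f j)"
    and lower: "\<And>x j. x \<in> S \<Longrightarrow> j \<in> J \<Longrightarrow> x j = a j \<Longrightarrow> f j x \<le> 0"
    and upper: "\<And>x j. x \<in> S \<Longrightarrow> j \<in> J \<Longrightarrow> x j = b j \<Longrightarrow> 0 \<le> f j x"
  obtains x where "x \<in> S" "\<And>j. j \<in> J \<Longrightarrow> f j x = 0"
proof -
  define n where "n = card J"
  obtain h where h: "bij_betw h J {..<n}"
    using ex_bij_betw_finite_nat[OF fin] by (auto simp: n_def atLeast0LessThan)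
  then have h_less: "h j < n" if "j \<in> J" for j
    using that by (auto simp: bij_betw_def)
  \<comment> \<open>\<open>S\<close> leaves the coordinates outside \<open>J\<close> free; pinning
    them to 0 gives a compact subset that contains all grid points.\<close>
  define C where "C = PiE UNIV (\<lambda>j. if j \<in> J then {a j..b j} else {0})"
  have "compactin (product_topology (\<lambda>_. euclidean) UNIV) C"
    unfolding C_def by (subst compactin_PiE) auto
  then have "seq_compact C"
    by (simp add: euclidean_product_topology compact_imp_seq_compact)
  have "C \<subseteq> S"
    by (auto simp: C_def S_def PiE_def Pi_def)
  define pt where "pt m q j = (if j \<in> J then a j + (b j - a j) * (real (q (h j)) / real (Suc m)) else 0)"
    for m :: nat and q :: "nat \<Rightarrow> nat" and j
  have pt_C: "pt m q \<in> C" if q: "\<And>i. i < n \<Longrightarrow> q i \<le> Suc m" for m q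
  proof -
    have "pt m q j \<in> {a j..b j}" if "j \<in> J" for j
    proof -
      have "real (q (h j)) / real (Suc m) \<le> 1"
        using q[OF h_less[OF that]] by (simp add: divide_le_eq)
      then have "(b j - a j) * (real (q (h j)) / real (Suc m)) \<le> (b j - a j) * 1"
        using ab[OF that] by (intro mult_left_mono) auto
      with ab[OF that] show ?thesis
        by (simp add: pt_def that)
    qed
    then show ?thesis
      by (auto simp: C_def pt_def)
  qed
  have "\<exists>q. (\<forall>i<n. q i \<le> Suc m) \<and> (\<forall>j\<in>J. \<exists>r s. (\<forall>i<n. r i \<le> Suc m \<and> s i \<le> Suc m
      \<and> q i \<le> r i \<and> r i \<le> q i + 1 \<and> q i \<le> s i \<and> s i \<le> q i + 1)
      \<and> f j (pt m r) \<le> 0 \<and> 0 \<le> f j (pt m s))" for m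
  proof -
    define g where "g i = inv_into J h i" for i
    have g: "g i \<in> J" "h (g i) = i" if "i < n" for i
      using h that by (auto simp: g_def bij_betw_def inv_into_into f_inv_into_f)
    have gh: "g (h j) = j" if "j \<in> J" for j
      using h that by (auto simp: g_def bij_betw_def)
    \<comment> \<open>On the two faces the label is prescribed, as Kuhn's lemma demands; elsewhere
      it records the sign of \<open>f\<close>. The face hypotheses ensure that labels 0 and 1 mean
      \<open>f \<le> 0\<close> and \<open>0 \<le> f\<close> on the faces too.\<close>
    define label where "label q i = (if q i = 0 \<or> (q i \<noteq> Suc m \<and> f (g i) (pt m q) < 0) then 0 else 1::nat)"
      for q i
    have label0: "f (g i) (pt m q) \<le> 0" if "label q i = 0" "i < n" "\<And>i. i < n \<Longrightarrow> q i \<le> Suc m" for q i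
    proof -
      have "f (g i) (pt m q) \<le> 0" if "q i = 0"
        using that pt_C[of q m] \<open>C \<subseteq> S\<close> g[OF \<open>i < n\<close>] \<open>\<And>i. i < n \<Longrightarrow> q i \<le> Suc m\<close>
        by (intro lower) (auto simp: pt_def)
      with that show ?thesis by (auto simp: label_def split: if_splits)
    qed
    have label1: "0 \<le> f (g i) (pt m q)" if "label q i = 1" "i < n" "\<And>i. i < n \<Longrightarrow> q i \<le> Suc m" for q i
    proof -
      have "0 \<le> f (g i) (pt m q)" if "q i = Suc m"
        using that pt_C[of q m] \<open>C \<subseteq> S\<close> g[OF \<open>i < n\<close>] \<open>\<And>i. i < n \<Longrightarrow> q i \<le> Suc m\<close>
        by (intro upper) (auto simp: pt_def)
      with that show ?thesis by (auto simp: label_def split: if_splits)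
    qed
    \<comment> \<open>\<open>q\<close> is the lowest corner of a grid cell; for every direction two
      corners of this cell carry different labels.\<close>
    obtain q where q: "\<forall>i<n. q i < Suc m"
      and rs: "\<forall>i<n. \<exists>r s. (\<forall>j<n. q j \<le> r j \<and> r j \<le> q j + 1)
        \<and> (\<forall>j<n. q j \<le> s j \<and> s j \<le> q j + 1) \<and> label r i \<noteq> label s i"
      by (rule kuhn_lemma[of "Suc m" n label]) (auto simp: label_def)
    have "\<exists>r s. (\<forall>i<n. r i \<le> Suc m \<and> s i \<le> Suc m
      \<and> q i \<le> r i \<and> r i \<le> q i + 1 \<and> q i \<le> s i \<and> s i \<le> q i + 1)
      \<and> f j (pt m r) \<le> 0 \<and> 0 \<le> f j (pt m s)" if j: "j \<in> J" for j
    proof -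
      obtain r s where r: "\<forall>i<n. q i \<le> r i \<and> r i \<le> q i + 1"
        and s: "\<forall>i<n. q i \<le> s i \<and> s i \<le> q i + 1" and "label r (h j) \<noteq> label s (h j)"
        using rs h_less[OF j] by blast
      then consider "label r (h j) = 0" "label s (h j) = 1" | "label r (h j) = 1" "label s (h j) = 0"
        by (auto simp: label_def split: if_splits)
      moreover have "r i \<le> Suc m \<and> s i \<le> Suc m" if "i < n" for i
        using r s q that by (metis Suc_eq_plus1 Suc_leI le_trans Suc_le_mono)
      ultimately show ?thesis
      proof cases
        case 1
        then show ?thesis
          using r s label0[of r "h j"] label1[of s "h j"] h_less[OF j] gh[OF j]
            \<open>\<And>i. i < n \<Longrightarrow> r i \<le> Suc m \<and> s i \<le> Suc m\<close>
          by (intro exI[of _ r] exI[of _ s]) auto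
      next
        case 2
        then show ?thesis
          using r s label0[of s "h j"] label1[of r "h j"] h_less[OF j] gh[OF j]
            \<open>\<And>i. i < n \<Longrightarrow> r i \<le> Suc m \<and> s i \<le> Suc m\<close>
          by (intro exI[of _ s] exI[of _ r]) auto
      qed
    qed
    with q show ?thesis
      by (intro exI[of _ q]) (auto intro: less_imp_le)
  qed
  then obtain q where q: "\<And>m i. i < n \<Longrightarrow> q m i \<le> Suc m"
    and "\<And>m. \<forall>j\<in>J. \<exists>r s. (\<forall>i<n. r i \<le> Suc m \<and> s i \<le> Suc m
      \<and> q m i \<le> r i \<and> r i \<le> q m i + 1 \<and> q m i \<le> s i \<and> s i \<le> q m i + 1)
      \<and> f j (pt m r) \<le> 0 \<and> 0 \<le> f j (pt m s)"
    by metis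
  then obtain r s where rs: "\<And>m j i. j \<in> J \<Longrightarrow> i < n \<Longrightarrow> r m j i \<le> Suc m \<and> s m j i \<le> Suc m
      \<and> q m i \<le> r m j i \<and> r m j i \<le> q m i + 1 \<and> q m i \<le> s m j i \<and> s m j i \<le> q m i + 1"
    and sgn: "\<And>m j. j \<in> J \<Longrightarrow> f j (pt m (r m j)) \<le> 0 \<and> 0 \<le> f j (pt m (s m j))"
    by metis
  have "pt m (q m) \<in> C" for m
    using q by (intro pt_C)
  then obtain z \<sigma> where "z \<in> C" "strict_mono \<sigma>"
    and lim: "((\<lambda>m. pt m (q m)) \<circ> \<sigma>) \<longlonglongrightarrow> z"
    using \<open>seq_compact C\<close> unfolding seq_compact_def by metis
  \<comment> \<open>Corners of the cell differ from \<open>q m\<close> by at most one grid step, so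
    along \<sigma> every choice of corners has the same limit \<open>z\<close>.\<close>
  have near: "(\<lambda>m. f j (pt (\<sigma> m) (t (\<sigma> m)))) \<longlonglongrightarrow> f j z"
    if "j \<in> J" and t: "\<And>m i. i < n \<Longrightarrow> t m i \<le> Suc m \<and> q m i \<le> t m i \<and> t m i \<le> q m i + 1" for j t
  proof -
    have "(\<lambda>m. pt (\<sigma> m) (t (\<sigma> m)) i) \<longlonglongrightarrow> z i" for i
    proof (rule Lim_transform2)
      show "(\<lambda>m. pt (\<sigma> m) (q (\<sigma> m)) i) \<longlonglongrightarrow> z i"
        using continuous_on_tendsto_compose[OF continuous_on_product_coordinates lim, of i]
        by (simp add: comp_def)
      have null: "(\<lambda>m. \<bar>b i - a i\<bar> * inverse (real (Suc (\<sigma> m)))) \<longlonglongrightarrow> \<bar>b i - a i\<bar> * 0"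
        using LIMSEQ_subseq_LIMSEQ[OF LIMSEQ_inverse_real_of_nat \<open>strict_mono \<sigma>\<close>]
        by (intro tendsto_intros) (simp add: comp_def)
      have bound: "norm (pt (\<sigma> m) (q (\<sigma> m)) i - pt (\<sigma> m) (t (\<sigma> m)) i)
          \<le> \<bar>b i - a i\<bar> * inverse (real (Suc (\<sigma> m)))" for m
      proof (cases "i \<in> J")
        case True
        have "pt (\<sigma> m) (q (\<sigma> m)) i - pt (\<sigma> m) (t (\<sigma> m)) i
            = (b i - a i) * ((real (q (\<sigma> m) (h i)) - real (t (\<sigma> m) (h i))) * inverse (real (Suc (\<sigma> m))))"
          using True by (simp add: pt_def divide_inverse left_diff_distrib[of "real _"]
              right_diff_distrib[of "b i - a i"] del: of_nat_Suc)
        moreover have "\<bar>real (q (\<sigma> m) (h i)) - real (t (\<sigma> m) (h i))\<bar> \<le> 1"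
          using t[of "h i" "\<sigma> m"] h_less[OF True] by linarith
        then have "\<bar>real (q (\<sigma> m) (h i)) - real (t (\<sigma> m) (h i))\<bar> * inverse (real (Suc (\<sigma> m)))
            \<le> 1 * inverse (real (Suc (\<sigma> m)))"
          by (rule mult_right_mono) simp
        ultimately show ?thesis
          by (simp add: abs_mult mult_left_mono del: of_nat_Suc)
      qed (simp add: pt_def)
      show "(\<lambda>m. pt (\<sigma> m) (q (\<sigma> m)) i - pt (\<sigma> m) (t (\<sigma> m)) i) \<longlonglongrightarrow> 0"
        by (rule Lim_null_comparison[OF always_eventually[OF allI[OF bound]]]) (use null in simp)
    qed
    then have "(\<lambda>m. pt (\<sigma> m) (t (\<sigma> m))) \<longlonglongrightarrow> z"
      using limitin_componentwise[of "\<lambda>_. euclideanreal" UNIV "\<lambda>m. pt (\<sigma> m) (t (\<sigma> m))" z sequentially]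
      by (simp add: euclidean_product_topology)
    moreover have "pt (\<sigma> m) (t (\<sigma> m)) \<in> S" for m
      using pt_C t \<open>C \<subseteq> S\<close> by blast
    moreover have "z \<in> S"
      using \<open>z \<in> C\<close> \<open>C \<subseteq> S\<close> by blast
    ultimately show ?thesis
      by (intro continuous_on_tendsto_compose[OF cont[OF \<open>j \<in> J\<close>]] always_eventually allI)
  qed
  show ?thesis
  proof (rule that)
    show "z \<in> S" using \<open>z \<in> C\<close> \<open>C \<subseteq> S\<close> by blast
    fix j assume j: "j \<in> J"
    have "f j z \<le> 0"
      using near[OF j, of "\<lambda>m. r m j"] rs[OF j] sgn[OF j] by (intro LIMSEQ_le_const2) auto
    moreover have "0 \<le> f j z"
      using near[OF j, of "\<lambda>m. s m j"] rs[OF j] sgn[OF j] by (intro LIMSEQ_le_const) auto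
    ultimately show "f j z = 0" by simp
  qed
qed

section \<open>Fluxes and meshes\<close>

text \<open>Together with the finiteness below, this lets index sets built from species serve in
  \<open>poincare_miranda\<close>.\<close>

instance species :: countable
  by countable_datatype

instance species :: finite
  by (standard, rule finite_subset[of _ "{Cation, Electron}"]) (auto intro: species.exhaust)

section \<open>The Bernoulli function and the kinetic exponentials\<close>

lemma bernoulli_fn_uminus: "bernoulli_fn (- x) = bernoulli_fn x + x"
proof (cases "x = 0")
  case False
  then have "exp x \<noteq> 1" by simp
  with False show ?thesis
    by (simp add: bernoulli_fn_def exp_minus field_simps)
qed (simp add: bernoulli_fn_def)

lemma bernoulli_fn_pos: "0 < bernoulli_fn x"
proof (cases "x = 0")
  case False
  then show ?thesis
    by (cases "x > 0") (auto simp: bernoulli_fn_def divide_neg_neg)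
qed (simp add: bernoulli_fn_def)

lemma isCont_bernoulli_fn: "isCont bernoulli_fn x"
proof (cases "x = 0")
  case True
  \<comment> \<open>Away from 0 the Bernoulli function is the reciprocal of the difference quotient
    of \<open>exp\<close> at 0, whose limit is 1.\<close>
  have "((\<lambda>h. (exp h - 1) / h) \<longlongrightarrow> 1) (at (0::real))"
    using DERIV_exp[of "0::real"] by (simp add: has_field_derivative_iff)
  from tendsto_inverse[OF this] have "((\<lambda>h::real. h / (exp h - 1)) \<longlongrightarrow> 1) (at 0)"
    by (simp add: inverse_eq_divide)
  then have "(bernoulli_fn \<longlongrightarrow> 1) (at 0)"
    by (rule Lim_transform_within[OF _ zero_less_one]) (simp add: bernoulli_fn_def)
  with True show ?thesis
    by (simp add: isCont_def bernoulli_fn_def)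
next
  case False
  have "isCont (\<lambda>y. y / (exp y - 1)) x"
    using False by (intro continuous_intros) auto
  moreover have "eventually (\<lambda>y. bernoulli_fn y = y / (exp y - 1)) (nhds x)"
    using t1_space_nhds[OF False] by eventually_elim (simp add: bernoulli_fn_def)
  ultimately show ?thesis
    by (simp add: isCont_cong)
qed

lemma continuous_on_bernoulli_fn [continuous_intros]:
  assumes "continuous_on S g"
  shows "continuous_on S (\<lambda>x. bernoulli_fn (g x))"
  using continuous_on_compose[OF assms continuous_at_imp_continuous_on, of bernoulli_fn]
  by (auto simp: comp_def isCont_bernoulli_fn)

text \<open>This is \<open>1 + y \<le> exp y\<close> at
  \<open>y = z * a * x + ln (\<alpha> * a * k)\<close>, divided by \<open>\<alpha> * a\<close>. It
  serves both boundary nodes: the left one with \<open>coef_a\<close> and \<open>coef_k\<close>, the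
  right one with \<open>coef_b\<close>, \<open>coef_m\<close> and the charge negated.\<close>

lemma kinetic_exp_bound:
  fixes \<alpha> a k z p x :: real
  assumes "\<alpha> > 0" "a > 0" "k > 0" and "0 \<le> 1 + ln (\<alpha> * a * k) + z * a * p"
  shows "z * (x - p) / \<alpha> \<le> k * exp (z * a * x)"
proof -
  have "z * a * (x - p) \<le> 1 + (z * a * x + ln (\<alpha> * a * k))"
    using assms(4) by (simp add: algebra_simps)
  also have "\<dots> \<le> exp (z * a * x + ln (\<alpha> * a * k))"
    by (rule exp_ge_add_one_self)
  also have "\<dots> = \<alpha> * a * k * exp (z * a * x)"
    using assms(1-3) by (simp add: exp_add)
  finally have "a * (z * (x - p)) \<le> a * (\<alpha> * (k * exp (z * a * x)))"
    by (simp add: mult_ac)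
  then show ?thesis
    using assms(1,2) by (simp add: pos_divide_le_eq mult_ac)
qed

lemma dPsi_cmult: "dPsi I e (\<lambda>i. c * psi i) i = c * dPsi I e psi i"
  by (simp add: dPsi_def algebra_simps)

section \<open>Geometry of the mesh\<close>

context
  fixes I :: nat and e :: "nat \<Rightarrow> real"
  assumes mesh: "is_mesh I e"
begin

lemma mesh_size_pos: "0 < I"
  using mesh by (cases I) (auto simp: is_mesh_def)

lemma mesh_mono: "i \<le> j \<Longrightarrow> j \<le> I \<Longrightarrow> e i \<le> e j"
proof (induction j rule: dec_induct)
  case (step m)
  then have "e m < e (Suc m)" "e i \<le> e m" using mesh by (auto simp: is_mesh_def)
  then show ?case by simp
qed simp

lemma mesh_range: "i \<le> I \<Longrightarrow> e i \<in> {0..1}"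
  using mesh_mono[of 0 i] mesh_mono[of i I] mesh by (auto simp: is_mesh_def)

lemma cell_size_pos: "i \<in> {1..I} \<Longrightarrow> 0 < cell_size e i"
  using mesh by (cases i) (auto simp: is_mesh_def cell_size_def)

lemma node_le_edge: "i \<le> I \<Longrightarrow> node I e i \<le> e i"
  using mesh cell_size_pos[of i] by (cases "i = 0") (auto simp: is_mesh_def cell_size_def node_def)

lemma edge_le_node: "i \<le> I \<Longrightarrow> e i \<le> node I e (i + 1)"
  using mesh cell_size_pos[of "i + 1"] mesh_mono[of i "i + 1"]
  by (cases "i = I") (auto simp: is_mesh_def cell_size_def node_def)

lemma node_dist_pos: "i \<le> I \<Longrightarrow> 0 < node_dist I e i"
proof (cases "i = 0")
  case True
  then show ?thesis
    using mesh cell_size_pos[of 1] mesh_size_pos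
    by (auto simp: is_mesh_def cell_size_def node_dist_def node_def)
next
  case False
  moreover assume "i \<le> I"
  ultimately have "node I e i < e i"
    using mesh cell_size_pos[of i] by (auto simp: cell_size_def node_def)
  with edge_le_node[OF \<open>i \<le> I\<close>] show ?thesis
    by (simp add: node_dist_def)
qed

lemma node_range:
  assumes "i \<le> I + 1"
  shows "node I e i \<in> {0..1}"
proof (cases "i = 0 \<or> i = I + 1")
  case False
  then have "e (i - 1) \<in> {0..1}" "e i \<in> {0..1}"
    using assms by (auto intro!: mesh_range simp del: atLeastAtMost_iff)
  with False show ?thesis
    by (simp add: node_def)
qed (auto simp: node_def)

section \<open>Comparison of potential slopes and of fluxes\<close>

lemma dPsi_antimono:
  assumes "i \<le> I" "psi i \<ge> chi i" "psi (i + 1) \<le> chi (i + 1)"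
  shows "dPsi I e psi i \<le> dPsi I e chi i"
  using assms node_dist_pos[of i] by (auto simp: dPsi_def intro!: divide_right_mono)

lemma flux_continuous:
  assumes "i \<le> I" "continuous_on S (\<lambda>x. psi x i)" "continuous_on S (\<lambda>x. psi x (i + 1))"
    "continuous_on S (\<lambda>x. w x i)" "continuous_on S (\<lambda>x. w x (i + 1))"
  shows "continuous_on S (\<lambda>x. flux I e u (psi x) (w x) i)"
  unfolding flux_def dPsi_def using assms node_dist_pos[of i] by (intro continuous_intros) auto

text \<open>Since \<open>bernoulli_fn\<close> is positive, raising the neighbour value to
  \<open>c\<close> only lowers the flux; by \<open>bernoulli_fn_uminus\<close> the flux of the
  constant state is pure drift.\<close>

lemma flux_ge:
  assumes "i \<le> I" "w i = c" "w (i + 1) \<le> c"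
  shows "- charge u * c * dPsi I e psi i \<le> flux I e u psi w i"
proof -
  define x h where "x = charge u * node_dist I e i * dPsi I e psi i" and "h = node_dist I e i"
  have "h > 0" unfolding h_def using assms(1) by (rule node_dist_pos)
  then have "- charge u * c * dPsi I e psi i = (bernoulli_fn x * c - bernoulli_fn (- x) * c) / h"
    by (simp add: bernoulli_fn_uminus x_def h_def field_simps)
  also have "\<dots> \<le> (bernoulli_fn x * c - bernoulli_fn (- x) * w (i + 1)) / h"
    using \<open>h > 0\<close> assms(3) less_imp_le[OF bernoulli_fn_pos]
    by (intro divide_right_mono diff_mono mult_left_mono) auto
  also have "\<dots> = flux I e u psi w i"
    by (simp add: flux_def assms(2) x_def h_def)
  finally show ?thesis .
qed

lemma flux_le:
  assumes "i \<le> I" "w i \<le> c" "w (i + 1) = c"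
  shows "flux I e u psi w i \<le> - charge u * c * dPsi I e psi i"
proof -
  define x h where "x = charge u * node_dist I e i * dPsi I e psi i" and "h = node_dist I e i"
  have "h > 0" unfolding h_def using assms(1) by (rule node_dist_pos)
  have "flux I e u psi w i = (bernoulli_fn x * w i - bernoulli_fn (- x) * c) / h"
    using assms(3) by (simp add: flux_def x_def h_def)
  also have "\<dots> \<le> (bernoulli_fn x * c - bernoulli_fn (- x) * c) / h"
    using \<open>h > 0\<close> assms(2) less_imp_le[OF bernoulli_fn_pos]
    by (intro divide_right_mono diff_mono mult_left_mono) auto
  also have "\<dots> = - charge u * c * dPsi I e psi i"
    using \<open>h > 0\<close> by (simp add: bernoulli_fn_uminus x_def h_def field_simps)
  finally show ?thesis .
qed

text \<open>The flux is linear in the density, so the bound at a maximum, applied to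
  \<open>- w\<close> with \<open>c = 0\<close>, handles a vanishing minimum.\<close>

lemma flux_nonpos: "i \<le> I \<Longrightarrow> w i = 0 \<Longrightarrow> 0 \<le> w (i + 1) \<Longrightarrow> flux I e u psi w i \<le> 0"
  using flux_ge[of i "\<lambda>j. - w j" 0 u psi] by (simp add: flux_def)

lemma flux_nonneg: "i \<le> I \<Longrightarrow> 0 \<le> w i \<Longrightarrow> w (i + 1) = 0 \<Longrightarrow> 0 \<le> flux I e u psi w i"
  using flux_le[of i "\<lambda>j. - w j" 0 u psi] by (simp add: flux_def)

end


section \<open>Residuals of one time step\<close>

text \<open>The rows are signed so that, on a mesh and with positive \<open>alpha0 D\<close> and
  \<open>alpha1 D\<close>, each increases in its own unknown and decreases in the neighbouring ones;
  \<open>lambda D\<close> is moved to the right-hand side.\<close>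

definition potential_op :: "corrosion_data \<Rightarrow> nat \<Rightarrow> (nat \<Rightarrow> real) \<Rightarrow> (nat \<Rightarrow> real) \<Rightarrow> nat \<Rightarrow> real" where
  "potential_op D I e psi i =
     (if i = 0 then psi 0 - alpha0 D * dPsi I e psi 0
      else if i = I + 1 then psi (I + 1) + alpha1 D * dPsi I e psi I
      else dPsi I e psi (i - 1) - dPsi I e psi i)"

definition potential_rhs ::
  "corrosion_data \<Rightarrow> nat \<Rightarrow> (nat \<Rightarrow> real) \<Rightarrow> (species \<Rightarrow> nat \<Rightarrow> real) \<Rightarrow> nat \<Rightarrow> real" where
  "potential_rhs D I e w i =
     (if i = 0 then pzc0 D
      else if i = I + 1 then appl_pot D - pzc1 D
      else cell_size e i * ((3 * w Cation i - w Electron i + rho_hl D) / (lambda D)\<^sup>2))"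

text \<open>Every row counts the flux leaving node \<open>i\<close> positively. This common
  orientation gives the same sign on the face \<open>w u i = 0\<close> at all nodes.\<close>

definition species_residual ::
  "corrosion_data \<Rightarrow> nat \<Rightarrow> (nat \<Rightarrow> real) \<Rightarrow> real \<Rightarrow> (species \<Rightarrow> nat \<Rightarrow> real)
   \<Rightarrow> (species \<Rightarrow> nat \<Rightarrow> real) \<Rightarrow> (nat \<Rightarrow> real) \<Rightarrow> species \<Rightarrow> nat \<Rightarrow> real" where
  "species_residual D I e dt v w psi u i =
     (if i = 0 then flux I e u psi (w u) 0 + beta_fn D u 0 (psi 0) * w u 0 - gamma0_fn D u (psi 0)
      else if i = I + 1 then
        beta_fn D u 1 (appl_pot D - psi (I + 1)) * w u (I + 1)
        - gamma1_fn D u (appl_pot D - psi (I + 1)) - flux I e u psi (w u) I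
      else eps_of D u * cell_size e i * ((w u i - v u i) / dt)
        + flux I e u psi (w u) i - flux I e u psi (w u) (i - 1))"

text \<open>
  Adding a multiple of the potential residual does not change the solution set.  The
  weights replace, in the drift of the constant state \<open>umax D u\<close>, the discrete field
  by the data of the potential equation, whose sign is known on the face \<open>w u i = umax D u\<close>;
  the factor \<open>w u i\<close> makes the correction vanish on the opposite face.
\<close>

definition coupled_residual ::
  "corrosion_data \<Rightarrow> nat \<Rightarrow> (nat \<Rightarrow> real) \<Rightarrow> real \<Rightarrow> (species \<Rightarrow> nat \<Rightarrow> real)
   \<Rightarrow> (species \<Rightarrow> nat \<Rightarrow> real) \<Rightarrow> (nat \<Rightarrow> real) \<Rightarrow> species \<Rightarrow> nat \<Rightarrow> real" where
  "coupled_residual D I e dt v w psi u i =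
     species_residual D I e dt v w psi u i
     - charge u * w u i * (potential_op D I e psi i - potential_rhs D I e w i)
       / (if i = 0 then alpha0 D else if i = I + 1 then alpha1 D else 1)"

text \<open>The four voltage bounds become two, indexed by the species and free of division: the
  sign of \<open>charge u\<close> makes \<open>Cation\<close> bound \<open>pzc0 D\<close> from below
  and \<open>Electron\<close> from above, and conversely for \<open>pzc1 D\<close>.\<close>

locale corrosion_scheme =
  fixes D :: corrosion_data and I :: nat and e :: "nat \<Rightarrow> real"
  assumes mesh: "is_mesh I e"
    and lambda_pos: "0 < lambda D" and alpha0_pos: "0 < alpha0 D" and alpha1_pos: "0 < alpha1 D"
    and epsilon_nonneg: "0 \<le> epsilon D"
    and umax_pos: "0 < umax D u"
    and coef_pos: "i \<in> {0, 1} \<Longrightarrow> 0 < coef_m D u i \<and> 0 < coef_k D u i"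
    and coef_a_pos: "0 < coef_a D u 0" and coef_b_pos: "0 < coef_b D u 1"
    and neutral: "3 * umax D Cation - umax D Electron + rho_hl D = 0"
    and pzc0_bound:
      "0 \<le> 1 + ln (alpha0 D * coef_a D u 0 * coef_k D u 0) + charge u * coef_a D u 0 * pzc0 D"
    and pzc1_bound:
      "0 \<le> 1 + ln (alpha1 D * coef_b D u 1 * coef_m D u 1) - charge u * coef_b D u 1 * pzc1 D"
begin

text \<open>Once the potential residuals vanish, the correction in \<open>coupled_residual\<close>
  drops out and the original transport rows are recovered.\<close>

lemma scheme_step_if_residuals_zero:
  assumes pot: "\<And>i. i \<le> I + 1 \<Longrightarrow> potential_op D I e psi i = potential_rhs D I e w i"
    and res: "\<And>u i. i \<le> I + 1 \<Longrightarrow> coupled_residual D I e dt v w psi u i = 0"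
  shows "scheme_step D I e dt v w psi"
proof -
  have spec: "species_residual D I e dt v w psi u i = 0" if "i \<le> I + 1" for u i
    using res[OF that] pot[OF that] by (simp add: coupled_residual_def)
  have "- (lambda D)\<^sup>2 * (dPsi I e psi i - dPsi I e psi (i - 1))
      = cell_size e i * (3 * w Cation i - w Electron i + rho_hl D)" if "i \<in> {1..I}" for i
  proof -
    have "- (lambda D)\<^sup>2 * (dPsi I e psi i - dPsi I e psi (i - 1))
        = (lambda D)\<^sup>2 * potential_op D I e psi i"
      using that by (simp add: potential_op_def algebra_simps)
    also have "\<dots> = cell_size e i * (3 * w Cation i - w Electron i + rho_hl D)"
      using pot[of i] that lambda_pos by (simp add: potential_rhs_def)
    finally show ?thesis .
  qed
  moreover have "eps_of D u * cell_size e i * ((w u i - v u i) / dt)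
        + flux I e u psi (w u) i - flux I e u psi (w u) (i - 1) = 0" if "i \<in> {1..I}" for u i
    using spec[of i u] that by (simp add: species_residual_def)
  moreover have "- flux I e u psi (w u) 0
        = beta_fn D u 0 (psi 0) * w u 0 - gamma0_fn D u (psi 0)" for u
    using spec[of 0 u] by (simp add: species_residual_def)
  moreover have "flux I e u psi (w u) I
        = beta_fn D u 1 (appl_pot D - psi (I + 1)) * w u (I + 1)
          - gamma1_fn D u (appl_pot D - psi (I + 1))" for u
    using spec[of "I + 1" u] by (simp add: species_residual_def)
  ultimately show ?thesis
    using pot[of 0] pot[of "I + 1"]
    unfolding scheme_step_def potential_op_def potential_rhs_def by auto
qed

text \<open>The factor \<open>w u i\<close> removes the correction, and an empty node gives nothing
  away: only the old content, incoming fluxes and the boundary source remain, all entering with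
  nonpositive sign.\<close>

lemma coupled_residual_lower:
  assumes "i \<le> I + 1" "0 < dt" and v: "i \<in> {1..I} \<Longrightarrow> 0 \<le> v u i"
    and w: "\<And>j. j \<le> I + 1 \<Longrightarrow> 0 \<le> w u j" and face: "w u i = 0"
  shows "coupled_residual D I e dt v w psi u i \<le> 0"
proof -
  consider "i = 0" | "i = I + 1" | "i \<in> {1..I}"
    using assms(1) by fastforce
  then have "species_residual D I e dt v w psi u i \<le> 0"
  proof cases
    case 1
    have "0 \<le> gamma0_fn D u (psi 0)"
      using coef_pos[of 0 u] umax_pos[of u] by (simp add: gamma0_fn_def)
    moreover have "flux I e u psi (w u) 0 \<le> 0"
      using 1 face w by (intro flux_nonpos[OF mesh]) auto
    ultimately show ?thesis
      using 1 face by (simp add: species_residual_def)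
  next
    case 2
    have "0 \<le> gamma1_fn D u (appl_pot D - psi (I + 1))"
      using coef_pos[of 1 u] umax_pos[of u] by (simp add: gamma1_fn_def)
    moreover have "0 \<le> flux I e u psi (w u) I"
      using 2 face w by (intro flux_nonneg[OF mesh]) auto
    ultimately show ?thesis
      using 2 face by (simp add: species_residual_def)
  next
    case 3
    have "0 \<le> eps_of D u * cell_size e i * (v u i / dt)"
      using v[OF 3] cell_size_pos[OF mesh 3] epsilon_nonneg \<open>0 < dt\<close> by (cases u) auto
    moreover have "flux I e u psi (w u) i \<le> 0"
      using 3 face w by (intro flux_nonpos[OF mesh]) auto
    moreover have "0 \<le> flux I e u psi (w u) (i - 1)"
      using 3 face w by (intro flux_nonneg[OF mesh]) auto
    ultimately show ?thesis
      using 3 face by (simp add: species_residual_def)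
  qed
  with face show ?thesis
    by (simp add: coupled_residual_def)
qed

text \<open>\<open>flux_ge\<close> and \<open>flux_le\<close> replace the fluxes by the drift of the
  constant state, and the correction cancels the resulting \<open>dPsi\<close> terms; what is left
  is boundary kinetics or charge density, each of the right sign.\<close>

lemma coupled_residual_upper:
  assumes "i \<le> I + 1" "0 < dt" and v: "i \<in> {1..I} \<Longrightarrow> v u i \<le> umax D u"
    and w: "\<And>u j. j \<le> I + 1 \<Longrightarrow> w u j \<le> umax D u" and face: "w u i = umax D u"
  shows "0 \<le> coupled_residual D I e dt v w psi u i"
proof -
  define z c where "z = charge u" and "c = umax D u"
  have "0 < c"
    unfolding c_def by (rule umax_pos)
  consider "i = 0" | "i = I + 1" | "i \<in> {1..I}"
    using assms(1) by fastforce
  then show ?thesis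
  proof cases
    case 1
    have "- z * c * dPsi I e psi 0 \<le> flux I e u psi (w u) 0"
      using 1 face w unfolding z_def c_def by (intro flux_ge[OF mesh]) auto
    moreover have "z * (psi 0 - pzc0 D) / alpha0 D
        \<le> coef_k D u 0 * exp (z * coef_a D u 0 * psi 0)"
      unfolding z_def using coef_pos[of 0 u] coef_a_pos pzc0_bound alpha0_pos
      by (intro kinetic_exp_bound) auto
    then have "c * (z * (psi 0 - pzc0 D) / alpha0 D)
        \<le> c * (coef_k D u 0 * exp (z * coef_a D u 0 * psi 0))"
      using \<open>0 < c\<close> by (intro mult_left_mono) auto
    \<comment> \<open>At the maximal density the \<open>coef_m\<close> part of
      \<open>beta_fn\<close> cancels \<open>gamma0_fn\<close>; at the right boundary the
      \<open>coef_k\<close> part cancels instead.\<close>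
    moreover have "beta_fn D u 0 (psi 0) * c - gamma0_fn D u (psi 0)
        = c * (coef_k D u 0 * exp (z * coef_a D u 0 * psi 0))"
      by (simp add: beta_fn_def gamma0_fn_def c_def z_def algebra_simps)
    moreover have "z * c * (psi 0 - alpha0 D * dPsi I e psi 0 - pzc0 D) / alpha0 D
        = c * (z * (psi 0 - pzc0 D) / alpha0 D) - z * c * dPsi I e psi 0"
      using alpha0_pos by (simp add: field_simps)
    ultimately show ?thesis
      using 1 face unfolding coupled_residual_def species_residual_def potential_op_def
        potential_rhs_def z_def c_def by simp
  next
    case 2
    \<comment> \<open>In terms of \<open>y\<close> the Robin residual is
      \<open>alpha1 D * dPsi I e psi I - (y - pzc1 D)\<close>, hence the kinetic bound with charge
      \<open>- z\<close>.\<close>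
    define y where "y = appl_pot D - psi (I + 1)"
    have "flux I e u psi (w u) I \<le> - z * c * dPsi I e psi I"
      using 2 face w unfolding z_def c_def by (intro flux_le[OF mesh]) auto
    moreover have "- z * (y - pzc1 D) / alpha1 D
        \<le> coef_m D u 1 * exp (- z * coef_b D u 1 * y)"
      unfolding z_def using coef_pos[of 1 u] coef_b_pos pzc1_bound[of u] alpha1_pos
      by (intro kinetic_exp_bound) auto
    then have "c * (- z * (y - pzc1 D) / alpha1 D)
        \<le> c * (coef_m D u 1 * exp (- z * coef_b D u 1 * y))"
      using \<open>0 < c\<close> by (intro mult_left_mono) auto
    moreover have "beta_fn D u 1 y * c - gamma1_fn D u y
        = c * (coef_m D u 1 * exp (- z * coef_b D u 1 * y))"
      by (simp add: beta_fn_def gamma1_fn_def c_def z_def algebra_simps)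
    moreover have "z * c * (psi (I + 1) + alpha1 D * dPsi I e psi I - (appl_pot D - pzc1 D)) / alpha1 D
        = c * (- z * (y - pzc1 D) / alpha1 D) + z * c * dPsi I e psi I"
      using alpha1_pos by (simp add: y_def field_simps)
    ultimately show ?thesis
      using 2 face unfolding coupled_residual_def species_residual_def potential_op_def
        potential_rhs_def z_def c_def y_def by simp
  next
    case 3
    have "0 \<le> eps_of D u * cell_size e i * ((c - v u i) / dt)"
      using v[OF 3] cell_size_pos[OF mesh 3] epsilon_nonneg \<open>0 < dt\<close> by (cases u) (auto simp: c_def)
    moreover have "- z * c * dPsi I e psi i \<le> flux I e u psi (w u) i"
      using 3 face w unfolding z_def c_def by (intro flux_ge[OF mesh]) auto
    moreover have "flux I e u psi (w u) (i - 1) \<le> - z * c * dPsi I e psi (i - 1)"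
      using 3 face w unfolding z_def c_def by (intro flux_le[OF mesh]) auto
    \<comment> \<open>By \<open>neutral\<close> the bracket is
      \<open>umax D Electron - w Electron i\<close> for a saturated cation and
      \<open>3 * (w Cation i - umax D Cation)\<close> for a saturated electron; neither is of the
      sign opposite to \<open>z\<close>.\<close>
    moreover have "0 \<le> z * (3 * w Cation i - w Electron i + rho_hl D)"
      using neutral w[of i Cation] w[of i Electron] 3 face unfolding z_def by (cases u) auto
    then have "0 \<le> (z * (3 * w Cation i - w Electron i + rho_hl D)) * (c * (cell_size e i / (lambda D)\<^sup>2))"
      using \<open>0 < c\<close> cell_size_pos[OF mesh 3] by (intro mult_nonneg_nonneg[of "z * _"]) auto
    then have "0 \<le> z * c * potential_rhs D I e w i"
      using 3 by (simp add: potential_rhs_def mult_ac)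
    moreover have "z * c * (potential_op D I e psi i - potential_rhs D I e w i)
        = z * c * dPsi I e psi (i - 1) - z * c * dPsi I e psi i - z * c * potential_rhs D I e w i"
      using 3 by (simp add: potential_op_def algebra_simps)
    moreover have "coupled_residual D I e dt v w psi u i
        = eps_of D u * cell_size e i * ((c - v u i) / dt)
        + flux I e u psi (w u) i - flux I e u psi (w u) (i - 1)
        - z * c * (potential_op D I e psi i - potential_rhs D I e w i)"
      using 3 face by (simp add: coupled_residual_def species_residual_def z_def c_def)
    ultimately show ?thesis
      by simp
  qed
qed

section \<open>Comparison principle and barrier for the discrete Poisson problem\<close>

lemma potential_op_cmult: "potential_op D I e (\<lambda>i. c * psi i) i = c * potential_op D I e psi i"
  by (simp add: potential_op_def dPsi_cmult algebra_simps)

text \<open>A discrete maximum principle at a contact point: the slopes towards the neighbours are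
  ordered there.\<close>

lemma potential_op_touching:
  assumes "i \<le> I + 1" "psi i = chi i" and le: "\<And>j. j \<le> I + 1 \<Longrightarrow> psi j \<le> chi j"
  shows "potential_op D I e chi i \<le> potential_op D I e psi i"
proof -
  have right: "dPsi I e psi i \<le> dPsi I e chi i" if "i \<le> I"
    using that assms le[of "i + 1"] by (intro dPsi_antimono[OF mesh]) auto
  have left: "dPsi I e chi (i - 1) \<le> dPsi I e psi (i - 1)" if "0 < i"
    using that assms le[of "i - 1"] by (intro dPsi_antimono[OF mesh]) auto
  show ?thesis
    using assms(1,2) right left alpha0_pos alpha1_pos by (auto simp: potential_op_def)
qed

text \<open>
  The second difference of \<open>x\<^sup>2\<close> over the nodes dominates the cell size, and the
  constant makes both Robin boundary terms at least \<open>1\<close>.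
\<close>

definition barrier :: "nat \<Rightarrow> real" where
  "barrier i = 2 + 2 * alpha1 D - (node I e i)\<^sup>2"

lemma barrier_pos: "i \<le> I + 1 \<Longrightarrow> 0 < barrier i"
  using node_range[OF mesh, of i] alpha1_pos power_le_one[of "node I e i" 2]
  by (simp add: barrier_def)

lemma dPsi_barrier: "i \<le> I \<Longrightarrow> dPsi I e barrier i = - (node I e i + node I e (i + 1))"
  using node_dist_pos[OF mesh, of i]
  by (simp add: dPsi_def barrier_def node_dist_def field_simps power2_eq_square)

lemma potential_op_barrier:
  assumes "i \<le> I + 1"
  shows "(if i \<in> {1..I} then cell_size e i else 1) \<le> potential_op D I e barrier i"
proof -
  consider "i = 0" | "i = I + 1" | "i \<in> {1..I}"
    using assms by fastforce
  then show ?thesis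
  proof cases
    case 1
    have "0 \<le> alpha0 D * node I e 1"
      using alpha0_pos node_range[OF mesh, of 1] by simp
    with 1 show ?thesis
      using alpha1_pos dPsi_barrier[of 0] by (simp add: potential_op_def barrier_def node_def)
  next
    case 2
    have "node I e (I + 1) = 1"
      by (simp add: node_def)
    moreover have "dPsi I e barrier I \<ge> - 2"
      using node_range[OF mesh, of I] dPsi_barrier[of I] \<open>node I e (I + 1) = 1\<close> by simp
    \<comment> \<open>The loss \<open>2 * alpha1 D\<close> is compensated by the constant in
      \<open>barrier\<close>; since the last node is at 1, exactly 1 is left.\<close>
    then have "alpha1 D * - 2 \<le> alpha1 D * dPsi I e barrier I"
      using alpha1_pos by (intro mult_left_mono) auto
    ultimately show ?thesis
      using 2 by (simp add: potential_op_def barrier_def)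
  next
    case 3
    then have "e i \<le> node I e (i + 1)" "node I e (i - 1) \<le> e (i - 1)"
      by (auto intro!: edge_le_node[OF mesh, of i, simplified] node_le_edge[OF mesh])
    \<comment> \<open>The slopes of \<open>barrier\<close> telescope to the distance between the two
      outer nodes, which encloses the cell.\<close>
    moreover have "potential_op D I e barrier i = node I e (i + 1) - node I e (i - 1)"
      using 3 dPsi_barrier[of i] dPsi_barrier[of "i - 1"] by (auto simp: potential_op_def)
    ultimately show ?thesis
      using 3 by (simp add: cell_size_def)
  qed
qed

text \<open>One multiple of the barrier dominates the right-hand sides for all densities in the box,
  so the bounds on the potential can be fixed in advance.\<close>

lemma potential_rhs_bounded:
  obtains M where "0 < M"
    "\<And>w i. i \<le> I + 1 \<Longrightarrow> (\<And>u. 0 \<le> w u i \<and> w u i \<le> umax D u)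
      \<Longrightarrow> \<bar>potential_rhs D I e w i\<bar> \<le> M * potential_op D I e barrier i"
proof
  define Q where "Q = (3 * umax D Cation + umax D Electron + \<bar>rho_hl D\<bar>) / (lambda D)\<^sup>2"
  define M where "M = \<bar>pzc0 D\<bar> + \<bar>appl_pot D - pzc1 D\<bar> + Q"
  have "0 < Q"
    using umax_pos[of Cation] umax_pos[of Electron] lambda_pos by (simp add: Q_def)
  then show "0 < M"
    by (simp add: M_def)
  fix w i
  assume i: "i \<le> I + 1" and w: "\<And>u. 0 \<le> w u i \<and> w u i \<le> umax D u"
  have "\<bar>potential_rhs D I e w i\<bar> \<le> M * (if i \<in> {1..I} then cell_size e i else 1)"
  proof (cases "i \<in> {1..I}")
    case True
    have "\<bar>(3 * w Cation i - w Electron i + rho_hl D) / (lambda D)\<^sup>2\<bar> \<le> Q"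
      using w[of Cation] w[of Electron] by (auto simp: Q_def abs_divide intro!: divide_right_mono)
    also have "Q \<le> M"
      by (simp add: M_def)
    finally have "cell_size e i * \<bar>(3 * w Cation i - w Electron i + rho_hl D) / (lambda D)\<^sup>2\<bar>
        \<le> cell_size e i * M"
      using cell_size_pos[OF mesh True] by (intro mult_left_mono) auto
    then show ?thesis
      using True cell_size_pos[OF mesh True] by (simp add: potential_rhs_def abs_mult mult.commute)
  next
    case False
    with i \<open>0 < Q\<close> show ?thesis
      by (auto simp: potential_rhs_def M_def)
  qed
  also have "\<dots> \<le> M * potential_op D I e barrier i"
    using \<open>0 < M\<close> potential_op_barrier[OF i] by (intro mult_left_mono) auto
  finally show "\<bar>potential_rhs D I e w i\<bar> \<le> M * potential_op D I e barrier i" .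
qed

section \<open>Existence for one time step and iteration in time\<close>

lemma scheme_step_exists:
  assumes "0 < dt" and v: "\<And>u i. i \<in> {1..I} \<Longrightarrow> 0 \<le> v u i \<and> v u i \<le> umax D u"
  obtains w psi where "scheme_step D I e dt v w psi"
    "\<And>u i. i \<le> I + 1 \<Longrightarrow> 0 \<le> w u i \<and> w u i \<le> umax D u"
proof -
  obtain M where "0 < M" and M: "\<And>w i. i \<le> I + 1 \<Longrightarrow> (\<And>u. 0 \<le> w u i \<and> w u i \<le> umax D u)
      \<Longrightarrow> \<bar>potential_rhs D I e w i\<bar> \<le> M * potential_op D I e barrier i"
    using potential_rhs_bounded by blast
  \<comment> \<open>\<open>None\<close> indexes the potential and \<open>Some u\<close> the density
    of species \<open>u\<close>, so all unknowns of a step form one vector.\<close>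
  define J :: "(species option \<times> nat) set" where "J = UNIV \<times> {..I + 1}"
  define lo hi where "lo j = (case j of (None, i) \<Rightarrow> - M * barrier i | (Some u, i) \<Rightarrow> 0)"
    and "hi j = (case j of (None, i) \<Rightarrow> M * barrier i | (Some u, i) \<Rightarrow> umax D u)"
    for j :: "species option \<times> nat"
  define psi w where "psi x i = x (None, i)" and "w x u i = x (Some u, i)"
    for x :: "species option \<times> nat \<Rightarrow> real" and u i
  define f where "f j x = (case j of
      (None, i) \<Rightarrow> potential_op D I e (psi x) i - potential_rhs D I e (w x) i
    | (Some u, i) \<Rightarrow> coupled_residual D I e dt v (w x) (psi x) u i)" for j x
  define S where "S = {x. \<forall>j\<in>J. lo j \<le> x j \<and> x j \<le> hi j}"
  have S: "0 \<le> w x u i \<and> w x u i \<le> umax D u" "- M * barrier i \<le> psi x i \<and> psi x i \<le> M * barrier i"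
    if "x \<in> S" "i \<le> I + 1" for x u i
  proof -
    have "(Some u, i) \<in> J" "(None, i) \<in> J"
      using that(2) by (simp_all add: J_def)
    with that(1) have "lo (Some u, i) \<le> x (Some u, i) \<and> x (Some u, i) \<le> hi (Some u, i)"
      "lo (None, i) \<le> x (None, i) \<and> x (None, i) \<le> hi (None, i)"
      unfolding S_def by blast+
    then show "0 \<le> w x u i \<and> w x u i \<le> umax D u" "- M * barrier i \<le> psi x i \<and> psi x i \<le> M * barrier i"
      by (simp_all add: lo_def hi_def w_def psi_def)
  qed
  obtain x where "x \<in> S" and x: "\<And>j. j \<in> J \<Longrightarrow> f j x = 0"
  proof (rule poincare_miranda[of J lo hi f, folded S_def])
    show "finite J"
      by (simp add: J_def)
  next
    fix j assume "j \<in> J"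
    then obtain k i where "j = (k, i)" and "i \<le> I + 1"
      by (auto simp: J_def)
    moreover from this have "0 < M * barrier i"
      using barrier_pos \<open>0 < M\<close> by simp
    ultimately show "lo j \<le> hi j"
      using less_imp_le[OF umax_pos] by (cases k) (simp_all add: lo_def hi_def)
  next
    fix j assume "j \<in> J"
    have cont_coord: "continuous_on S (\<lambda>x. psi x i)" "continuous_on S (\<lambda>x. w x u i)" for i u
      unfolding psi_def w_def
      by (rule continuous_on_subset[OF continuous_on_product_coordinates subset_UNIV])+
    have cont_dPsi: "continuous_on S (\<lambda>x. dPsi I e (psi x) i)" if "i \<le> I" for i
      unfolding dPsi_def using node_dist_pos[OF mesh that] by (intro continuous_intros cont_coord) auto
    have cont_flux: "continuous_on S (\<lambda>x. flux I e u (psi x) (w x u) i)" if "i \<le> I" for u i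
      by (intro flux_continuous[OF mesh that] cont_coord)
    have cont_pot: "continuous_on S (\<lambda>x. potential_op D I e (psi x) i - potential_rhs D I e (w x) i)"
      if i: "i \<le> I + 1" for i
    proof -
      \<comment> \<open>With the position of \<open>i\<close> fixed, the conditionals in the
        definitions disappear and the continuity rules apply.\<close>
      consider "i = 0" | "i = I + 1" | "0 < i" "i \<le> I"
        using i by fastforce
      then show ?thesis
        using lambda_pos unfolding potential_op_def potential_rhs_def
        by cases (simp; intro continuous_intros cont_coord cont_dPsi; simp)+
    qed
    moreover have "continuous_on S (\<lambda>x. coupled_residual D I e dt v (w x) (psi x) u i)"
      if i: "i \<le> I + 1" for u i
    proof -
      have "continuous_on S (\<lambda>x. species_residual D I e dt v (w x) (psi x) u i)"
      proof -
        consider "i = 0" | "i = I + 1" | "0 < i" "i \<le> I"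
          using i by fastforce
        then show ?thesis
          using \<open>0 < dt\<close> unfolding species_residual_def beta_fn_def gamma0_fn_def gamma1_fn_def
          by cases (simp; intro continuous_intros cont_coord cont_flux; simp)+
      qed
      moreover have "continuous_on S (\<lambda>x. charge u * w x u i
          * (potential_op D I e (psi x) i - potential_rhs D I e (w x) i))"
        by (rule continuous_on_mult[OF continuous_on_mult[OF continuous_on_const cont_coord(2)] cont_pot[OF i]])
      ultimately show ?thesis
        unfolding coupled_residual_def using alpha0_pos alpha1_pos
        by (intro continuous_on_diff continuous_on_divide continuous_on_const) auto
    qed
    ultimately show "continuous_on S (f j)"
      using \<open>j \<in> J\<close>
      by (cases j; cases "fst j") (auto simp: f_def J_def)
  next
    fix x j
    assume "x \<in> S" and "j \<in> J" and eq: "x j = lo j"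
    obtain k i where j: "j = (k, i)" and i: "i \<le> I + 1"
      using \<open>j \<in> J\<close> by (auto simp: J_def)
    show "f j x \<le> 0"
    proof (cases k)
      case None
      \<comment> \<open>On this face the potential touches \<open>- M * barrier\<close> from above,
        so its row is at most that of \<open>- M * barrier\<close>, hence at most
        \<open>potential_rhs\<close>.\<close>
      have "potential_op D I e (psi x) i \<le> potential_op D I e (\<lambda>i. - M * barrier i) i"
        using S[OF \<open>x \<in> S\<close>] eq i by (intro potential_op_touching) (auto simp: j None lo_def psi_def)
      then show ?thesis
        using M[of i "w x"] S(1)[OF \<open>x \<in> S\<close> i] i potential_op_cmult[of "- M" barrier i]
        by (simp add: f_def j None abs_le_iff)
    next
      case (Some u)
      have "coupled_residual D I e dt v (w x) (psi x) u i \<le> 0"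
        using S(1)[OF \<open>x \<in> S\<close>] v eq i \<open>0 < dt\<close>
        by (intro coupled_residual_lower) (auto simp: j Some lo_def w_def)
      then show ?thesis
        by (simp add: f_def j Some)
    qed
  next
    fix x j
    assume "x \<in> S" and "j \<in> J" and eq: "x j = hi j"
    obtain k i where j: "j = (k, i)" and i: "i \<le> I + 1"
      using \<open>j \<in> J\<close> by (auto simp: J_def)
    show "0 \<le> f j x"
    proof (cases k)
      case None
      have "potential_op D I e (\<lambda>i. M * barrier i) i \<le> potential_op D I e (psi x) i"
        using S[OF \<open>x \<in> S\<close>] eq i by (intro potential_op_touching) (auto simp: j None hi_def psi_def)
      then show ?thesis
        using M[of i "w x"] S(1)[OF \<open>x \<in> S\<close> i] i potential_op_cmult[of "M" barrier i]
        by (simp add: f_def j None abs_le_iff)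
    next
      case (Some u)
      have "0 \<le> coupled_residual D I e dt v (w x) (psi x) u i"
        using S(1)[OF \<open>x \<in> S\<close>] v eq i \<open>0 < dt\<close>
        by (intro coupled_residual_upper) (auto simp: j Some hi_def w_def)
      then show ?thesis
        by (simp add: f_def j Some)
    qed
  qed blast
  have "scheme_step D I e dt v (w x) (psi x)"
  proof (rule scheme_step_if_residuals_zero)
    fix i assume "i \<le> I + 1"
    then show "potential_op D I e (psi x) i = potential_rhs D I e (w x) i"
      using x[of "(None, i)"] by (simp add: f_def J_def)
  next
    fix u i assume "i \<le> I + 1"
    then show "coupled_residual D I e dt v (w x) (psi x) u i = 0"
      using x[of "(Some u, i)"] by (simp add: f_def J_def)
  qed
  then show ?thesis
    using S(1)[OF \<open>x \<in> S\<close>] by (rule that)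
qed

text \<open>Dependent choice over the time levels. Only density bounds are carried along, since a
  step uses no potential from the level before.\<close>

lemma scheme_solution_exists:
  assumes "0 < T" "1 \<le> K"
    and init: "\<And>u i. i \<in> {1..I} \<Longrightarrow>
      (1 / cell_size e i) * (LINT x:{e (i - 1)..e i}|lebesgue. uinit u x) \<in> {0..umax D u}"
  shows "\<exists>U Psi. scheme_solution D uinit T K I e U Psi
           \<and> (\<forall>u. \<forall>k\<in>{1..K}. \<forall>i\<in>{0..I + 1}. 0 \<le> U u k i \<and> U u k i \<le> umax D u)
           \<and> (\<forall>u. \<forall>i\<in>{1..I}. 0 \<le> U u 0 i \<and> U u 0 i \<le> umax D u)"
proof -
  define u0 where "u0 u i = (1 / cell_size e i) * (LINT x:{e (i - 1)..e i}|lebesgue. uinit u x)" for u i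
  \<comment> \<open>At level 0 densities are given in the cells only, hence \<open>{1..I}\<close>;
    from level 1 on the bounds cover the boundary nodes too.\<close>
  define ok where "ok k s \<longleftrightarrow>
      (\<forall>u. \<forall>i\<in>(if k = 0 then {1..I} else {0..I + 1}). 0 \<le> fst s u i \<and> fst s u i \<le> umax D u)
      \<and> (k = 0 \<longrightarrow> fst s = u0)"
    for k :: nat and s :: "(species \<Rightarrow> nat \<Rightarrow> real) \<times> (nat \<Rightarrow> real)"
  have "\<exists>s. \<forall>k. ok k (s k) \<and> scheme_step D I e (T / real K) (fst (s k)) (fst (s (Suc k))) (snd (s (Suc k)))"
  proof (rule dependent_nat_choice)
    show "\<exists>s. ok 0 s"
      \<comment> \<open>The zero potential at level 0 is a placeholder.\<close>
      using init by (intro exI[of _ "(u0, \<lambda>_. 0)"]) (auto simp: ok_def u0_def)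
  next
    fix s k assume "ok k s"
    then have bnd: "0 \<le> fst s u i \<and> fst s u i \<le> umax D u" if "i \<in> {1..I}" for u i
      using that by (auto simp: ok_def split: if_splits)
    have "0 < T / real K"
      using assms(1,2) by simp
    obtain w psi where "scheme_step D I e (T / real K) (fst s) w psi"
      "\<And>u i. i \<le> I + 1 \<Longrightarrow> 0 \<le> w u i \<and> w u i \<le> umax D u"
      using scheme_step_exists[of "T / real K" "fst s", OF \<open>0 < T / real K\<close> bnd] by blast
    then show "\<exists>s'. ok (Suc k) s' \<and> scheme_step D I e (T / real K) (fst s) (fst s') (snd s')"
      by (intro exI[of _ "(w, psi)"]) (auto simp: ok_def)
  qed
  then obtain s where ok: "\<And>k. ok k (s k)"
    and step: "\<And>k. scheme_step D I e (T / real K) (fst (s k)) (fst (s (Suc k))) (snd (s (Suc k)))"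
    by blast
  define U Psi where "U u k = fst (s k) u" and "Psi k = snd (s k)" for u k
  have "scheme_solution D uinit T K I e U Psi"
    using step ok[of 0] by (simp add: scheme_solution_def U_def Psi_def ok_def u0_def)
  moreover have "0 \<le> U u k i \<and> U u k i \<le> umax D u" if "k \<in> {1..K}" "i \<in> {0..I + 1}" for u k i
    using ok[of k] that by (auto simp: ok_def U_def)
  moreover have "0 \<le> U u 0 i \<and> U u 0 i \<le> umax D u" if "i \<in> {1..I}" for u i
    using ok[of 0] that by (auto simp: ok_def U_def)
  ultimately show ?thesis
    by blast
qed

end

section \<open>Averages of the initial data and the full theorem\<close>

lemma set_average_bounds:
  fixes f :: "real \<Rightarrow> real"
  assumes "p < q" "0 \<le> c" and bnd: "AE x in lebesgue. x \<in> {p..q} \<longrightarrow> 0 \<le> f x \<and> f x \<le> c"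
  shows "1 / (q - p) * (LINT x:{p..q}|lebesgue. f x) \<in> {0..c}"
proof -
  have nonneg: "0 \<le> (LINT x:{p..q}|lebesgue. f x)"
    unfolding set_lebesgue_integral_def using bnd
    by (intro integral_nonneg_AE) (auto elim!: eventually_mono simp: indicator_def)
  have "(LINT x:{p..q}|lebesgue. f x) \<le> c * (q - p)"
  proof (cases "set_integrable lebesgue {p..q} f")
    case True
    have "(LINT x:{p..q}|lebesgue. f x) \<le> (LINT x:{p..q}|lebesgue. c)"
    proof (rule set_integral_mono_AE[OF True])
      show "set_integrable lebesgue {p..q} (\<lambda>_. c)"
        by (simp add: set_integrable_def lmeasurable_iff_integrable[symmetric])
      show "AE x \<in> {p..q} in lebesgue. f x \<le> c"
        using bnd by eventually_elim simp
    qed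
    also have "\<dots> = c * (q - p)"
      using \<open>p < q\<close> by (simp add: set_lebesgue_integral_def)
    finally show ?thesis .
  next
    \<comment> \<open>The integral of a non-integrable function is 0 by convention, which satisfies
      the bound.\<close>
    case False
    then show ?thesis
      using assms(1,2) by (simp add: set_lebesgue_integral_def set_integrable_def not_integrable_integral_eq)
  qed
  with nonneg \<open>p < q\<close> show ?thesis
    by (simp add: divide_le_eq)
qed

theorem proposition1p1:
  fixes D :: corrosion_data
    and uinit :: "species \<Rightarrow> real \<Rightarrow> real"
    and T :: real and K I :: nat and e :: "nat \<Rightarrow> real"
  assumes "T > 0" and "lambda D > 0"
    and "\<And>u. umax D u > 0"
    and "epsilon D \<ge> 0" and "alpha0 D > 0" and "alpha1 D > 0"
    and "\<And>u i. i \<in> {0, 1} \<Longrightarrow> coef_m D u i > 0 \<and> coef_k D u i > 0"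
    and "\<And>u i. i \<in> {0, 1} \<Longrightarrow> coef_a D u i \<in> {0..1} \<and> coef_b D u i \<in> {0..1}"
    and "coef_a D Cation 0 > 0" and "coef_a D Electron 0 > 0"
    and "coef_b D Cation 1 > 0" and "coef_b D Electron 1 > 0"
    and "\<And>u. Linfty01 (uinit u)"
    and "\<And>u. AE x in lebesgue_on {0<..<1}. 0 \<le> uinit u x \<and> uinit u x \<le> umax D u"
    and "3 * umax D Cation - umax D Electron + rho_hl D = 0"
    and "- (1 / (3 * coef_a D Cation 0)) * (1 + ln (alpha0 D * coef_a D Cation 0 * coef_k D Cation 0))
           \<le> pzc0 D"
    and "pzc0 D \<le> (1 / coef_a D Electron 0)
           * (1 + ln (alpha0 D * coef_a D Electron 0 * coef_k D Electron 0))"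
    and "- (1 / coef_b D Electron 1) * (1 + ln (alpha1 D * coef_b D Electron 1 * coef_m D Electron 1))
           \<le> pzc1 D"
    and "pzc1 D \<le> (1 / (3 * coef_b D Cation 1))
           * (1 + ln (alpha1 D * coef_b D Cation 1 * coef_m D Cation 1))"
    and "is_mesh I e" and "K \<ge> 1"
  shows "\<exists>U Psi. scheme_solution D uinit T K I e U Psi
           \<and> (\<forall>u. \<forall>k\<in>{1..K}. \<forall>i\<in>{0..I + 1}. 0 \<le> U u k i \<and> U u k i \<le> umax D u)
           \<and> (\<forall>u. \<forall>i\<in>{1..I}. 0 \<le> U u 0 i \<and> U u 0 i \<le> umax D u)"
proof -
  have coef: "coef_a D u 0 > 0" "coef_b D u 1 > 0" for u
    using assms(9-12) by (cases u; simp)+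
  interpret corrosion_scheme D I e
  proof
    fix u
    show "0 \<le> 1 + ln (alpha0 D * coef_a D u 0 * coef_k D u 0) + charge u * coef_a D u 0 * pzc0 D"
      using assms(9,10,16,17) by (cases u) (auto simp: field_simps)
    show "0 \<le> 1 + ln (alpha1 D * coef_b D u 1 * coef_m D u 1) - charge u * coef_b D u 1 * pzc1 D"
      using assms(11,12,18,19) by (cases u) (auto simp: field_simps)
  qed (use assms coef in auto)
  have "(1 / cell_size e i) * (LINT x:{e (i - 1)..e i}|lebesgue. uinit u x) \<in> {0..umax D u}"
    if i: "i \<in> {1..I}" for u i
  proof -
    have "AE x in lebesgue. x \<in> {0<..<1} \<longrightarrow> 0 \<le> uinit u x \<and> uinit u x \<le> umax D u"
      using assms(14)[of u] by (rule AE_restrict_space_iff[THEN iffD1, rotated]) simp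
    \<comment> \<open>The closed cells may contain the endpoints 0 and 1, which a statement on the
      open interval misses; both are null sets.\<close>
    moreover have "AE x in lebesgue. x \<noteq> (0::real)" "AE x in lebesgue. x \<noteq> (1::real)"
      by (auto intro!: AE_completion AE_lborel_singleton)
    ultimately have "AE x in lebesgue. x \<in> {e (i - 1)..e i} \<longrightarrow> 0 \<le> uinit u x \<and> uinit u x \<le> umax D u"
    proof eventually_elim
      case (elim x)
      moreover have "e (i - 1) \<in> {0..1}" "e i \<in> {0..1}"
        using i by (auto intro!: mesh_range[OF mesh, simplified])
      ultimately show ?case
        by auto
    qed
    then show ?thesis
      using set_average_bounds[of "e (i - 1)" "e i" "umax D u" "uinit u"]
        cell_size_pos[OF mesh i] umax_pos[of u] by (simp add: cell_size_def)
  qed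
  then show ?thesis
    using assms(1,21) by (intro scheme_solution_exists)
qed

end
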